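(* For every $n\geq 8$, resolving sets do not have the exchange property in the $n$-wheel $W_n$: there exist minimal resolving sets $S,R$ of $W_n$ and $r\in R$ such that for every $s\in S$ the set $(S\setminus\{s\})\cup\{r\}$ is not a minimal resolving set of $W_n$.
   Context: The $n$-wheel $W_n$ is the join of the cycle $C_n$ with $K_1$: an $n$-cycle together with one additional vertex adjacent to every vertex of the cycle. For a connected graph $G$ with shortest-path distance $d$, $W\subseteq V(G)$ is a resolving set if for every two distinct vertices $u,v$ there is $w\in W$ with $d(w,u)\neq d(w,v)$; it is minimal if no proper subset is a resolving set. Resolving sets have the exchange property in $G$ if whenever $S,R$ are minimal resolving sets and $r\in R$, there is $s\in S$ with $(S\setminus\{s\})\cup\{r\}$ a minimal resolving set. *)

theory Defs
  imports
    "Graph_Theory.Digraph_Component"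
    "Graph_Theory.Pair_Digraph"
    "Graph_Theory.Shortest_Path"
begin

text \<open>Graphs are symmetric digraphs, as in the Graph_Theory library: every undirected edge is
  a pair of opposite arcs.\<close>

text \<open>This is the simple cycle only for \<open>n \<ge> 3\<close>.\<close>

definition cycle_graph :: "nat \<Rightarrow> nat pair_pre_digraph" where
  "cycle_graph n = \<lparr> pverts = {..<n},
     parcs = {(i, j). i < n \<and> j < n \<and> (j = Suc i mod n \<or> i = Suc j mod n)} \<rparr>"

definition graph_join ::
  "'a pair_pre_digraph \<Rightarrow> 'b pair_pre_digraph \<Rightarrow> ('a + 'b) pair_pre_digraph" where
  "graph_join G H = \<lparr> pverts = pverts G <+> pverts H,
     parcs = map_prod Inl Inl ` parcs G \<union> map_prod Inr Inr ` parcs H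
       \<union> (Inl ` pverts G) \<times> (Inr ` pverts H) \<union> (Inr ` pverts H) \<times> (Inl ` pverts G) \<rparr>"

definition K1 :: "unit pair_pre_digraph" where
  "K1 = \<lparr> pverts = {()}, parcs = {} \<rparr>"

definition wheel :: "nat \<Rightarrow> (nat + unit) pair_pre_digraph" where
  "wheel n = graph_join (cycle_graph n) K1"

text \<open>With unit weights the cost of a walk is its number of edges, so the infimum is the
  shortest-path distance, and \<open>\<infinity>\<close> between different components.\<close>

definition graph_dist :: "('a, 'b) pre_digraph \<Rightarrow> 'a \<Rightarrow> 'a \<Rightarrow> ereal" where
  "graph_dist G u v = wf_digraph.\<mu> G (\<lambda>_. 1) u v"

definition resolving_set :: "('a, 'b) pre_digraph \<Rightarrow> 'a set \<Rightarrow> bool" where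
  "resolving_set G W \<longleftrightarrow> W \<subseteq> verts G \<and>
     (\<forall>u \<in> verts G. \<forall>v \<in> verts G. u \<noteq> v \<longrightarrow> (\<exists>w \<in> W. graph_dist G w u \<noteq> graph_dist G w v))"

definition minimal_resolving_set :: "('a, 'b) pre_digraph \<Rightarrow> 'a set \<Rightarrow> bool" where
  "minimal_resolving_set G W \<longleftrightarrow> resolving_set G W \<and> (\<forall>W'. W' \<subset> W \<longrightarrow> \<not> resolving_set G W')"

definition resolving_exchange_property :: "('a, 'b) pre_digraph \<Rightarrow> bool" where
  "resolving_exchange_property G \<longleftrightarrow>
     (\<forall>S R. minimal_resolving_set G S \<longrightarrow> minimal_resolving_set G R \<longrightarrow>
        (\<forall>r \<in> R. \<exists>s \<in> S. minimal_resolving_set G ((S - {s}) \<union> {r})))"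

lemma parcs_wheel:
  "parcs (wheel n) =
     {(Inl i, Inl j) | i j. i < n \<and> j < n \<and> (j = Suc i mod n \<or> i = Suc j mod n)}
     \<union> {(Inl i, Inr ()) | i. i < n} \<union> {(Inr (), Inl i) | i. i < n}"
  by (auto simp: wheel_def graph_join_def cycle_graph_def K1_def)

lemma pverts_wheel: "pverts (wheel n) = insert (Inr ()) (Inl ` {..<n})"
  by (auto simp: wheel_def graph_join_def cycle_graph_def K1_def)

lemma pair_graph_wheel:
  assumes "n \<ge> 3"
  shows "pair_graph (wheel n)"
proof -
  have loopfree: "Suc i mod n \<noteq> i" if "i < n" for i
    using that assms by (cases "Suc i = n") auto
  have "finite (pverts (wheel n))"
    by (simp add: pverts_wheel)
  moreover have "parcs (wheel n) \<subseteq> pverts (wheel n) \<times> pverts (wheel n)"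
    by (auto simp: parcs_wheel pverts_wheel)
  ultimately have fin: "finite (parcs (wheel n))"
    by (meson finite_SigmaI finite_subset)
  have "sym (parcs (wheel n))"
    by (auto simp: sym_def parcs_wheel)
  then have sym: "symmetric (with_proj (wheel n))"
    by (simp add: symmetric_def)
  show ?thesis
    using fin sym by unfold_locales (auto simp: parcs_wheel pverts_wheel loopfree dest: loopfree)
qed

lemma connected_wheel:
  assumes "n \<ge> 3"
  shows "Digraph_Component.connected (with_proj (wheel n))"
proof -
  interpret pair_graph "wheel n"
    using assms by (rule pair_graph_wheel)
  have to_hub: "u \<rightarrow>\<^sup>*\<^bsub>with_proj (wheel n)\<^esub> Inr ()" if "u \<in> pverts (wheel n)" for u
    using that by (cases u) (auto simp: pverts_wheel parcs_wheel)
  have from_hub: "Inr () \<rightarrow>\<^sup>*\<^bsub>with_proj (wheel n)\<^esub> u" if "u \<in> pverts (wheel n)" for u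
    using that by (cases u) (auto simp: pverts_wheel parcs_wheel)
  show ?thesis
    unfolding Digraph_Component.connected_def
    by (rule strongly_connectedI)
      (auto simp: pverts_wheel intro!: reachable_mk_symmetricI reachable_trans[OF to_hub from_hub])
qed

end

theory Submission
  imports Defs
begin

text \<open>All distances in a wheel are at most 2, so a set of rim vertices resolves the wheel iff the
  vertices outside it have pairwise different neighbourhoods in it and none of these neighbourhoods
  is the whole set. Call the maximal runs of rim vertices outside the set its gaps. For \<open>n \<noteq> 9\<close>
  take a set \<open>S\<close> containing \<open>1, 2, 6\<close> and thereafter every other vertex, ending with \<open>n - 1\<close>; it is
  minimal. Inserting \<open>0\<close> and removing a vertex other than \<open>1\<close> and \<open>n - 1\<close> creates two gap vertices
  with the same neighbourhood, whereas inserting \<open>0\<close> makes both \<open>1\<close> and \<open>n - 1\<close> superfluous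
  simultaneously, so removing only one of them leaves a set that is not minimal. For \<open>n = 9\<close> this
  breaks down, and \<open>{1, 3, 6, 8}\<close> with \<open>0\<close> serves instead. The second set \<open>R\<close> only has to contain
  \<open>0\<close>: any minimal resolving subset of a resolving set that stops resolving without \<open>0\<close> will do.\<close>

section \<open>Distances 0, 1 and 2 read off from walk lengths\<close>

lemma (in wf_digraph) awalk_cost_unit: "awalk_cost (\<lambda>_. 1) p = real (length p)"
  by (induction p) auto

lemma (in wf_digraph) graph_dist_le:
  assumes "awalk u p v" shows "graph_dist G u v \<le> ereal (length p)"
  using min_cost_le_walk_cost[OF assms, of "\<lambda>_. 1"] by (simp add: graph_dist_def awalk_cost_unit)

lemma (in wf_digraph) graph_dist_ge:
  assumes "\<And>p. awalk u p v \<Longrightarrow> k \<le> length p"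
  shows "ereal k \<le> graph_dist G u v"
  unfolding graph_dist_def \<mu>_def by (rule INF_greatest) (simp add: awalk_cost_unit assms)

lemma (in wf_digraph) graph_dist_same:
  assumes "u \<in> verts G" shows "graph_dist G u u = 0"
proof (rule antisym)
  show "graph_dist G u u \<le> 0"
    using graph_dist_le[of u "[]" u] assms by (simp add: awalk_Nil_iff zero_ereal_def)
  show "0 \<le> graph_dist G u u"
    using graph_dist_ge[of u u 0] by (simp add: zero_ereal_def)
qed

lemma (in wf_digraph) graph_dist_adjacent:
  assumes "u \<rightarrow>\<^bsub>G\<^esub> v" "u \<noteq> v" shows "graph_dist G u v = 1"
proof (rule antisym)
  obtain e where "arc e (u, v)"
    using assms(1) by (auto simp: arcs_ends_def arc_to_ends_def arc_def)
  then have "awalk u [e] v"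
    by (auto simp: arc_def awalk_Cons_iff awalk_Nil_iff)
  from graph_dist_le[OF this] show "graph_dist G u v \<le> 1"
    by (simp add: one_ereal_def)
  have "1 \<le> length p" if "awalk u p v" for p
    using that assms(2) by (cases p) (auto simp: awalk_Nil_iff)
  from graph_dist_ge[OF this] show "1 \<le> graph_dist G u v"
    by (simp add: one_ereal_def)
qed

lemma (in wf_digraph) graph_dist_two:
  assumes "u \<rightarrow>\<^bsub>G\<^esub> w" "w \<rightarrow>\<^bsub>G\<^esub> v" "\<not> u \<rightarrow>\<^bsub>G\<^esub> v" "u \<noteq> v"
  shows "graph_dist G u v = 2"
proof (rule antisym)
  obtain e f where "arc e (u, w)" "arc f (w, v)"
    using assms(1,2) by (auto simp: arcs_ends_def arc_to_ends_def arc_def)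
  then have "awalk u [e, f] v"
    by (auto simp: arc_def awalk_Cons_iff awalk_Nil_iff)
  from graph_dist_le[OF this] show "graph_dist G u v \<le> 2"
    by simp
  have "2 \<le> length p" if p: "awalk u p v" for p
  proof (rule ccontr)
    assume "\<not> 2 \<le> length p"
    then consider "p = []" | e where "p = [e]"
      by (cases p rule: remdups_adj.cases) auto
    then show False
      using p assms(3,4)
      by cases (auto simp: awalk_Cons_iff awalk_Nil_iff arcs_ends_def arc_to_ends_def)
  qed
  from graph_dist_ge[OF this] show "2 \<le> graph_dist G u v"
    by simp
qed

section \<open>Minimal resolving sets in an arbitrary graph\<close>

lemma resolving_set_mono:
  assumes "resolving_set G A" "A \<subseteq> B" "B \<subseteq> verts G"
  shows "resolving_set G B"
  using assms unfolding resolving_set_def by blast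

text \<open>Resolving passes to larger vertex sets, so deletions of single vertices decide
  minimality.\<close>

lemma minimal_resolving_setI:
  assumes "resolving_set G W" "\<And>w. w \<in> W \<Longrightarrow> \<not> resolving_set G (W - {w})"
  shows "minimal_resolving_set G W"
proof -
  have "\<not> resolving_set G W'" if "W' \<subset> W" for W'
  proof
    assume res: "resolving_set G W'"
    from that obtain w where w: "w \<in> W" "W' \<subseteq> W - {w}" by blast
    have "W - {w} \<subseteq> verts G"
      using assms(1) by (auto simp: resolving_set_def)
    from resolving_set_mono[OF res w(2) this] assms(2)[OF w(1)] show False by simp
  qed
  with assms(1) show ?thesis
    by (simp add: minimal_resolving_set_def)
qed

text \<open>A minimal resolving subset of \<open>T\<close> missing \<open>r\<close> would lie in
  \<open>T - {r}\<close>, which would then resolve.\<close>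

lemma minimal_resolving_set_containing:
  assumes "finite T" "resolving_set G T" "\<not> resolving_set G (T - {r})"
  obtains R where "minimal_resolving_set G R" "r \<in> R"
proof -
  let ?F = "{A. A \<subseteq> T \<and> resolving_set G A}"
  have "finite ?F" "T \<in> ?F"
    using assms(1,2) by simp_all
  then obtain R where R: "R \<in> ?F" and min: "\<And>A. A \<in> ?F \<Longrightarrow> A \<subseteq> R \<Longrightarrow> R = A"
    using finite_has_minimal[of ?F] by auto
  have "minimal_resolving_set G R"
    unfolding minimal_resolving_set_def using R min by auto
  moreover have "r \<in> R"
  proof (rule ccontr)
    assume "r \<notin> R"
    then have "R \<subseteq> T - {r}" using R by auto
    moreover have "T - {r} \<subseteq> verts G"
      using assms(2) by (auto simp: resolving_set_def)
    ultimately show False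
      using R assms(3) resolving_set_mono[of G R "T - {r}"] by simp
  qed
  ultimately show thesis by (rule that)
qed

lemma not_resolving_exchange_propertyI:
  assumes "finite T" "resolving_set G T" "\<not> resolving_set G (T - {r})"
    and "minimal_resolving_set G S"
    and "\<And>s. s \<in> S \<Longrightarrow> \<not> minimal_resolving_set G (S - {s} \<union> {r})"
  shows "\<not> resolving_exchange_property G"
proof -
  obtain R where "minimal_resolving_set G R" "r \<in> R"
    using assms(1-3) by (rule minimal_resolving_set_containing)
  with assms(4,5) show ?thesis
    unfolding resolving_exchange_property_def by blast
qed

section \<open>From the wheel to its rim\<close>

definition rim_adj :: "nat \<Rightarrow> nat \<Rightarrow> nat \<Rightarrow> bool" where
  "rim_adj n i j \<longleftrightarrow> j = Suc i \<or> i = Suc j \<or> (i = 0 \<and> Suc j = n) \<or> (j = 0 \<and> Suc i = n)"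

text \<open>Splitting the \<open>mod\<close> into cases leaves an adjacency open to linear
  arithmetic.\<close>

lemma rim_adj_iff_arc:
  assumes "i < n" "j < n"
  shows "Inl i \<rightarrow>\<^bsub>with_proj (wheel n)\<^esub> Inl j \<longleftrightarrow> rim_adj n i j"
  using assms by (auto simp: parcs_wheel rim_adj_def mod_Suc)

lemma graph_dist_wheel:
  assumes "n \<ge> 3" "i < n"
  shows "graph_dist (with_proj (wheel n)) (Inl i) (Inr ()) = 1"
    and "j < n \<Longrightarrow> graph_dist (with_proj (wheel n)) (Inl i) (Inl j) =
      (if i = j then 0 else if rim_adj n i j then 1 else 2)"
proof -
  interpret pair_graph "wheel n"
    using assms(1) by (rule pair_graph_wheel)
  show "graph_dist (with_proj (wheel n)) (Inl i) (Inr ()) = 1"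
    using assms by (intro graph_dist_adjacent) (auto simp: parcs_wheel)
  show "graph_dist (with_proj (wheel n)) (Inl i) (Inl j) =
      (if i = j then 0 else if rim_adj n i j then 1 else 2)" if "j < n"
    using assms that graph_dist_same[of "Inl i"] graph_dist_adjacent[of "Inl i" "Inl j"]
      graph_dist_two[of "Inl i" "Inr ()" "Inl j"] rim_adj_iff_arc[of i n j]
    by (auto simp: parcs_wheel pverts_wheel)
qed

text \<open>The first conjunct separates rim vertices from the hub, the second from each other.
  Members of \<open>W\<close> drop out, each being the only vertex at distance 0 from
  itself.\<close>

definition rim_resolving :: "nat \<Rightarrow> nat set \<Rightarrow> bool" where
  "rim_resolving n W \<longleftrightarrow> (\<forall>v<n. v \<notin> W \<longrightarrow> (\<exists>w\<in>W. \<not> rim_adj n w v)) \<and>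
     (\<forall>u v. u < n \<and> v < n \<and> u \<noteq> v \<longrightarrow> u \<notin> W \<and> v \<notin> W \<longrightarrow>
       (\<exists>w\<in>W. rim_adj n w u \<noteq> rim_adj n w v))"

lemma rim_resolvingI:
  assumes "\<And>v. v < n \<Longrightarrow> v \<notin> W \<Longrightarrow> \<exists>w\<in>W. \<not> rim_adj n w v"
    and less: "\<And>u v. u < v \<Longrightarrow> v < n \<Longrightarrow> u \<notin> W \<Longrightarrow> v \<notin> W \<Longrightarrow>
      \<exists>w\<in>W. rim_adj n w u \<noteq> rim_adj n w v"
  shows "rim_resolving n W"
proof -
  have "\<exists>w\<in>W. rim_adj n w u \<noteq> rim_adj n w v"
    if "u < n" "v < n" "u \<noteq> v" "u \<notin> W" "v \<notin> W" for u v
  proof (cases "u < v")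
    case True then show ?thesis using less that by blast
  next
    case False
    then have "v < u" using that by simp
    from less[OF this] show ?thesis using that by metis
  qed
  with assms(1) show ?thesis unfolding rim_resolving_def by simp
qed

text \<open>From a vertex of \<open>W\<close> the hub is at distance 1, and a rim vertex outside
  \<open>W\<close> is at distance 1 or 2 according to adjacency.\<close>

lemma resolving_set_wheel_iff:
  assumes "n \<ge> 3" "W \<subseteq> {..<n}"
  shows "resolving_set (with_proj (wheel n)) (Inl ` W) \<longleftrightarrow> rim_resolving n W"
proof -
  let ?d = "graph_dist (with_proj (wheel n))"
  have hub: "(\<exists>w\<in>W. ?d (Inl w) (Inl v) \<noteq> ?d (Inl w) (Inr ())) \<longleftrightarrow>
      (v \<notin> W \<longrightarrow> (\<exists>w\<in>W. \<not> rim_adj n w v))" if "v < n" for v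
    using assms that by (auto simp: graph_dist_wheel subset_iff)
  have rim: "(\<exists>w\<in>W. ?d (Inl w) (Inl u) \<noteq> ?d (Inl w) (Inl v)) \<longleftrightarrow>
      (u \<notin> W \<and> v \<notin> W \<longrightarrow> (\<exists>w\<in>W. rim_adj n w u \<noteq> rim_adj n w v))"
    if "u < n" "v < n" "u \<noteq> v" for u v
  proof (cases "u \<in> W \<or> v \<in> W")
    case True
    then show ?thesis
      using assms that by (force simp: graph_dist_wheel subset_iff)
  next
    case False
    then have "?d (Inl w) (Inl u) \<noteq> ?d (Inl w) (Inl v) \<longleftrightarrow> rim_adj n w u \<noteq> rim_adj n w v"
      if "w \<in> W" for w
      using assms that \<open>u < n\<close> \<open>v < n\<close> by (auto simp: graph_dist_wheel subset_iff)
    then show ?thesis using False by auto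
  qed
  have "resolving_set (with_proj (wheel n)) (Inl ` W) \<longleftrightarrow>
      (\<forall>v<n. \<exists>w\<in>W. ?d (Inl w) (Inl v) \<noteq> ?d (Inl w) (Inr ())) \<and>
      (\<forall>u v. u < n \<and> v < n \<and> u \<noteq> v \<longrightarrow> (\<exists>w\<in>W. ?d (Inl w) (Inl u) \<noteq> ?d (Inl w) (Inl v)))"
    using assms(2) by (auto simp: resolving_set_def pverts_wheel eq_commute[of "?d _ (Inr ())"])
  also have "\<dots> \<longleftrightarrow> rim_resolving n W"
    unfolding rim_resolving_def using hub rim
    by (intro arg_cong2[where f = "(\<and>)"] all_cong1 imp_cong refl) simp_all
  finally show ?thesis .
qed

lemma not_rim_resolvingI:
  assumes "u < n" "v < n" "u \<noteq> v" "u \<notin> W" "v \<notin> W"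
    and "\<And>w. w \<in> W \<Longrightarrow> rim_adj n w u \<longleftrightarrow> rim_adj n w v"
  shows "\<not> rim_resolving n W"
  using assms unfolding rim_resolving_def by blast

lemma rim_resolving_mono:
  assumes "rim_resolving n A" "A \<subseteq> B"
  shows "rim_resolving n B"
proof -
  have sub: "(\<exists>w\<in>A. P w) \<Longrightarrow> (\<exists>w\<in>B. P w)" and notin: "v \<notin> B \<Longrightarrow> v \<notin> A" for P v
    using assms(2) by blast+
  show ?thesis
    using assms(1) unfolding rim_resolving_def by (auto dest!: notin intro!: sub)
qed

text \<open>\<open>T\<close> yields the minimal resolving set containing \<open>r\<close>. By
  \<open>ex\<close>, an exchanged set either fails to resolve or properly contains a resolving
  set.\<close>

lemma wheel_not_exchangeI:
  assumes "n \<ge> 3" "S \<subseteq> {..<n}" "T \<subseteq> {..<n}" "r < n" "r \<notin> S"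
    and T: "rim_resolving n T" "\<not> rim_resolving n (T - {r})"
    and S: "rim_resolving n S" "\<And>s. s \<in> S \<Longrightarrow> \<not> rim_resolving n (S - {s})"
    and ex: "\<And>s. s \<in> S \<Longrightarrow> rim_resolving n (insert r (S - {s})) \<Longrightarrow>
        \<exists>W \<subset> insert r (S - {s}). rim_resolving n W"
  shows "\<not> resolving_exchange_property (with_proj (wheel n))"
proof (rule not_resolving_exchange_propertyI)
  let ?G = "with_proj (wheel n)"
  note iff = resolving_set_wheel_iff[OF assms(1)]
  have diff: "Inl ` W - {Inl x} = (Inl ` (W - {x}) :: (nat + unit) set)" for W x
    by auto
  show "finite (Inl ` T :: (nat + unit) set)"
    using assms(3) finite_subset by blast
  show "resolving_set ?G (Inl ` T)" "\<not> resolving_set ?G (Inl ` T - {Inl r})"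
    using T assms(3) iff[of T] iff[of "T - {r}"] unfolding diff by auto
  show "minimal_resolving_set ?G (Inl ` S)"
  proof (rule minimal_resolving_setI)
    show "resolving_set ?G (Inl ` S)"
      using iff[OF assms(2)] S(1) by simp
    fix s :: "nat + unit" assume "s \<in> Inl ` S"
    then obtain x where x: "s = Inl x" "x \<in> S" by blast
    have "S - {x} \<subseteq> {..<n}" using assms(2) by blast
    from iff[OF this] show "\<not> resolving_set ?G (Inl ` S - {s})"
      using S(2)[OF x(2)] x(1) diff by simp
  qed
  fix s :: "nat + unit" assume "s \<in> Inl ` S"
  then obtain x where x: "s = Inl x" "x \<in> S" by blast
  let ?S' = "insert r (S - {x})"
  have S': "?S' \<subseteq> {..<n}" using assms(2,4) by blast
  have eq: "Inl ` S - {s} \<union> {Inl r} = Inl ` ?S'"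
    using x by auto
  show "\<not> minimal_resolving_set ?G (Inl ` S - {s} \<union> {Inl r})"
  proof
    assume min: "minimal_resolving_set ?G (Inl ` S - {s} \<union> {Inl r})"
    then have "rim_resolving n ?S'"
      unfolding eq using iff[OF S'] by (simp only: minimal_resolving_set_def)
    from ex[OF x(2) this] obtain W where W: "W \<subset> ?S'" "rim_resolving n W" by blast
    then have "W \<subseteq> {..<n}" using S' by blast
    then have "resolving_set ?G (Inl ` W)" using iff W(2) by blast
    moreover have "Inl ` W \<subset> (Inl ` ?S' :: (nat + unit) set)"
      using W(1) by (intro image_strict_mono) auto
    ultimately show False
      using min unfolding eq minimal_resolving_set_def by blast
  qed
qed

section \<open>The wheel with nine rim vertices\<close>

lemma wheel_9_not_exchange: "\<not> resolving_exchange_property (with_proj (wheel 9))"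
\<comment> \<open>\<open>T\<close> is \<open>S\<close> rotated by one place, so that it contains
  0.\<close>
proof (rule wheel_not_exchangeI[where S = "{1, 3, 6, 8}" and T = "{0, 2, 5, 7}" and r = 0])
  show "rim_resolving 9 {0, 2, 5, 7}"
    unfolding rim_resolving_def rim_adj_def by simp presburger
  show "rim_resolving 9 {1, 3, 6, 8}"
    unfolding rim_resolving_def rim_adj_def by simp presburger
  show "\<not> rim_resolving 9 ({0, 2, 5, 7} - {0})"
    by (rule not_rim_resolvingI[of 1 _ 3]) (auto simp: rim_adj_def)
  \<comment> \<open>No exchanged set resolves here; since \<open>S - {s}\<close> is a subset of it,
    this also gives the minimality of \<open>S\<close>.\<close>
  have *: "\<not> rim_resolving 9 (insert 0 ({1, 3, 6, 8} - {s}))" if "s \<in> {1, 3, 6, 8}" for s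
  proof -
    consider "s = 1" | "s = 3" | "s = 6" | "s = 8" using \<open>s \<in> _\<close> by auto
    then show ?thesis
    proof cases
      case 1 then show ?thesis
        by (intro not_rim_resolvingI[of 2 _ 4]) (auto simp: rim_adj_def)
    next
      case 2 then show ?thesis
        by (intro not_rim_resolvingI[of 3 _ 4]) (auto simp: rim_adj_def)
    next
      case 3 then show ?thesis
        by (intro not_rim_resolvingI[of 5 _ 6]) (auto simp: rim_adj_def)
    next
      case 4 then show ?thesis
        by (intro not_rim_resolvingI[of 5 _ 7]) (auto simp: rim_adj_def)
    qed
  qed
  show "\<not> rim_resolving 9 ({1, 3, 6, 8} - {s})" if "s \<in> {1, 3, 6, 8}" for s
    using *[OF that] rim_resolving_mono by blast
  show "\<exists>W \<subset> insert 0 ({1, 3, 6, 8} - {s}). rim_resolving 9 W"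
    if "s \<in> {1, 3, 6, 8}" "rim_resolving 9 (insert 0 ({1, 3, 6, 8} - {s}))" for s
    using * that by blast
qed auto

section \<open>The remaining wheels\<close>

lemma wheel_not_exchange:
  fixes n :: nat
  assumes "n \<ge> 8" "n \<noteq> 9"
  shows "\<not> resolving_exchange_property (with_proj (wheel n))"
proof -
  \<comment> \<open>The parity condition counts back from \<open>n - 1\<close> in steps of two, down
    to 7 or 8. The gaps are \<open>{0}\<close>, \<open>{3, 4, 5}\<close> and single
    vertices.\<close>
  define S where "S = {j. j = 1 \<or> j = 2 \<or> j = 6 \<or> (7 \<le> j \<and> j < n \<and> odd (n + j))}"
  \<comment> \<open>This is \<open>S\<close> with 0 in place of both 1 and \<open>n - 1\<close>. It
    serves twice: as the source of \<open>R\<close> and as the smaller resolving set inside an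
    exchanged set. For \<open>n = 9\<close> it would be \<open>{0, 2, 6}\<close>, where 5 and 7 both
    see only 6.\<close>
  define T where "T = {j. j = 0 \<or> j = 2 \<or> j = 6 \<or> (7 \<le> j \<and> j + 1 < n \<and> odd (n + j))}"
  have T: "rim_resolving n T"
  proof -
    have "\<exists>w\<in>T. \<not> rim_adj n w v" for v
    proof -
      have "\<not> rim_adj n 0 v \<or> \<not> rim_adj n 2 v \<or> \<not> rim_adj n 6 v"
        using assms unfolding rim_adj_def by presburger
      then show ?thesis unfolding T_def by blast
    qed
    moreover have False if uv: "u < v" "v < n" "u \<notin> T" "v \<notin> T"
      and eq: "\<And>w. w \<in> T \<Longrightarrow> rim_adj n w u \<longleftrightarrow> rim_adj n w v" for u v
    proof -
      have c: "rim_adj n w u \<longleftrightarrow> rim_adj n w v"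
        if "w = 0 \<or> w = 2 \<or> w = 6 \<or> (7 \<le> w \<and> w + 1 < n \<and> odd (n + w))" for w
        using eq that unfolding T_def by blast
      have "v \<noteq> 6" and even: "7 \<le> v \<Longrightarrow> v + 1 < n \<Longrightarrow> even (n + v)"
        using uv(4) by (auto simp: T_def)
      then consider "v \<le> 5" | "v = n - 1" | "7 \<le> v" "v + 2 < n" | "v = n - 2" "10 \<le> n"
        using uv(2) assms by linarith
      then show False
      proof cases
        case 1
        \<comment> \<open>The neighbourhoods of 1, 3, 4, 5 in \<open>T\<close> are
          \<open>{0, 2}\<close>, \<open>{2}\<close>, \<open>{}\<close>, \<open>{6}\<close>.\<close>
        then have "u \<in> {1, 3, 4}" "v \<in> {3, 4, 5}"
          using uv(1,3,4) unfolding T_def by auto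
        then show ?thesis
          using uv(1) assms c[of 0] c[of 2] c[of 6]
          by (elim insertE emptyE) (simp_all add: rim_adj_def)
      next
        case 2
        \<comment> \<open>Of the two neighbours 1 and \<open>n - 1\<close> of 0, only 1 is adjacent
          to 2.\<close>
        then show ?thesis
          using uv(1) assms c[of 0] c[of 2] unfolding rim_adj_def by auto
      next
        case 3
        \<comment> \<open>By parity \<open>v + 1\<close> is in \<open>T\<close>; it is adjacent to
          \<open>v\<close> but not to the smaller \<open>u\<close>.\<close>
        moreover have "u \<noteq> 0" using uv(3) by (auto simp: T_def)
        ultimately show ?thesis
          using uv(1) even c[of "v + 1"] unfolding rim_adj_def by auto
      next
        case 4
        \<comment> \<open>Now \<open>v + 1 = n - 1\<close> is not in \<open>T\<close>, so the member
          \<open>k + 2\<close> below \<open>v\<close> is used. Its other neighbour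
          \<open>k + 1\<close> also sees \<open>k\<close>, which is in \<open>T\<close>:
          \<open>k = 5\<close> would put \<open>u = 6\<close> into \<open>T\<close>,
          \<open>k = 6\<close> is listed, and larger \<open>k\<close> have the right parity.\<close>
        then obtain k where k: "n = k + 5" "v = k + 3" "5 \<le> k"
          by (auto dest!: le_Suc_ex)
        have "u \<noteq> 0" using uv(3) by (auto simp: T_def)
        moreover have "rim_adj n (k + 2) u \<longleftrightarrow> rim_adj n (k + 2) v"
          by (rule c) (use k in simp)
        ultimately have u: "u = k + 1"
          using uv(1) k by (simp add: rim_adj_def)
        then have "k \<noteq> 5" using uv(3) by (auto simp: T_def)
        then have "rim_adj n k u \<longleftrightarrow> rim_adj n k v"
          by (intro c) (use k in auto)
        then show ?thesis
          using k u by (simp add: rim_adj_def)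
      qed
    qed
    ultimately show ?thesis by (intro rim_resolvingI) blast+
  qed
  have S: "rim_resolving n S"
  proof -
    have "\<exists>w\<in>S. \<not> rim_adj n w v" for v
    proof -
      have "\<not> rim_adj n 1 v \<or> \<not> rim_adj n 2 v \<or> \<not> rim_adj n 6 v"
        using assms unfolding rim_adj_def by presburger
      then show ?thesis unfolding S_def by blast
    qed
    moreover have False if uv: "u < v" "v < n" "u \<notin> S" "v \<notin> S"
      and eq: "\<And>w. w \<in> S \<Longrightarrow> rim_adj n w u \<longleftrightarrow> rim_adj n w v" for u v
    proof -
      have c: "rim_adj n w u \<longleftrightarrow> rim_adj n w v"
        if "w = 1 \<or> w = 2 \<or> w = 6 \<or> (7 \<le> w \<and> w < n \<and> odd (n + w))" for w
        using eq that unfolding S_def by blast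
      have "v \<noteq> 6" "v \<noteq> n - 1" and even: "7 \<le> v \<Longrightarrow> even (n + v)"
        using uv(2,4) assms(1) by (auto simp: S_def)
      then consider "v \<le> 5" | "7 \<le> v" "v + 1 < n"
        using uv(2) by linarith
      then show False
      proof cases
        case 1
        then have "u \<in> {0, 3, 4}" "v \<in> {3, 4, 5}"
          using uv(1,3,4) unfolding S_def by auto
        then show ?thesis
          using uv(1) assms c[of 1] c[of 2] c[of 6]
          by (elim insertE emptyE) (simp_all add: rim_adj_def)
      next
        case 2
        \<comment> \<open>The member \<open>v + 1\<close> separates \<open>v\<close> from
          \<open>u\<close> unless \<open>u = 0\<close> and \<open>v + 1 = n - 1\<close>; then 1
          does, being adjacent to 0 only.\<close>
        then show ?thesis
          using uv(1) even c[of 1] c[of "v + 1"] unfolding rim_adj_def by auto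
      qed
    qed
    ultimately show ?thesis by (intro rim_resolvingI) blast+
  qed
  have mid: "\<not> rim_resolving n (insert 0 (S - {s}))" if s: "s \<in> S" "s \<noteq> 1" "s \<noteq> n - 1" for s
  proof -
    have "s = 2 \<or> s = 6 \<or> (7 \<le> s \<and> s < n - 1)" and odd: "7 \<le> s \<Longrightarrow> odd (n + s)"
      using s by (auto simp: S_def)
    \<comment> \<open>Without 2, vertices 3 and 4 see nothing; without 6, neither do 4 and 5;
      without 7, both 5 and 7 see only 6; without a later \<open>s\<close>, both \<open>s\<close>
      and 4 see nothing. For \<open>n = 8\<close>, 7 is \<open>n - 1\<close>.\<close>
    then consider "s = 2" | "s = 6" | "s = 7" "10 \<le> n" | "8 \<le> s" "s < n - 1"
      using assms by linarith
    then show ?thesis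
    proof cases
      case 1 then show ?thesis using assms
        by (intro not_rim_resolvingI[of 3 _ 4]) (auto simp: S_def rim_adj_def)
    next
      case 2 then show ?thesis using assms
        by (intro not_rim_resolvingI[of 4 _ 5]) (auto simp: S_def rim_adj_def)
    next
      case 3 then show ?thesis using odd
        by (intro not_rim_resolvingI[of 5 _ 7]) (auto simp: S_def rim_adj_def)
    next
      case 4 then show ?thesis using odd
        by (intro not_rim_resolvingI[of 4 _ s]) (auto simp: S_def rim_adj_def)
    qed
  qed
  show ?thesis
  proof (rule wheel_not_exchangeI[where S = S and T = T and r = 0])
    \<comment> \<open>Without 0, both 1 and 3 see only 2.\<close>
    show "\<not> rim_resolving n (T - {0})"
      using assms by (intro not_rim_resolvingI[of 1 _ 3]) (auto simp: T_def rim_adj_def)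
    show "\<not> rim_resolving n (S - {s})" if s: "s \<in> S" for s
    proof -
      \<comment> \<open>As 0 is not in \<open>S\<close>, its neighbours 1 and \<open>n - 1\<close>
        are still indispensable. Without 1, both 1 and 3 see only 2; without \<open>n - 1\<close>,
        this vertex sees only 6, like 5, if \<open>n = 8\<close>, and nothing, like 4,
        otherwise.\<close>
      consider "s \<noteq> 1" "s \<noteq> n - 1" | "s = 1" | "s = n - 1" "n = 8" | "s = n - 1" "n \<ge> 10"
        using assms by linarith
      then show ?thesis
      proof cases
        case 1 then show ?thesis using mid[OF s] rim_resolving_mono by blast
      next
        case 2 then show ?thesis using assms
          by (intro not_rim_resolvingI[of 1 _ 3]) (auto simp: S_def rim_adj_def)
      next
        case 3 then show ?thesis
          by (intro not_rim_resolvingI[of 5 _ 7]) (auto simp: S_def rim_adj_def)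
      next
        case 4
        then have "n = Suc s" by simp
        with 4(2) show ?thesis
          by (intro not_rim_resolvingI[of 4 _ s]) (auto simp: S_def rim_adj_def)
      qed
    qed
    show "\<exists>W \<subset> insert 0 (S - {s}). rim_resolving n W"
      if s: "s \<in> S" and res: "rim_resolving n (insert 0 (S - {s}))" for s
    proof -
      have s_cases: "s = 1 \<or> s = n - 1"
        using mid[OF s] res by (metis (full_types))
      have "odd (n + (n - 1))"
        using assms(1) by presburger
      then have "1 \<in> S" "n - 1 \<in> S" "1 \<noteq> n - 1"
        using assms(1) by (auto simp: S_def)
      \<comment> \<open>The one of 1 and \<open>n - 1\<close> that survives is not in
        \<open>T\<close>, which makes \<open>T\<close> a proper subset.\<close>
      then have "1 \<in> S - {s} \<or> n - 1 \<in> S - {s}"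
        using s_cases by (metis DiffI singletonD)
      moreover have "1 \<notin> T" "n - 1 \<notin> T"
        using assms(1) by (auto simp: T_def)
      ultimately have "T \<noteq> insert 0 (S - {s})"
        by (metis insertCI)
      moreover have "T \<subseteq> insert 0 (S - {1, n - 1})"
        using assms(1) by (auto simp: S_def T_def)
      then have "T \<subseteq> insert 0 (S - {s})"
        using s_cases by (elim disjE) auto
      ultimately show ?thesis using T by blast
    qed
    show "S \<subseteq> {..<n}" "T \<subseteq> {..<n}" "0 \<notin> S"
      using assms(1) by (auto simp: S_def T_def)
  qed (use assms S T in auto)
qed

theorem theorem15:
  fixes n :: nat
  assumes "n \<ge> 8"
  shows "\<not> resolving_exchange_property (with_proj (wheel n))"
proof (cases "n = 9")
  case True
  then show ?thesis using wheel_9_not_exchange by simp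
next
  case False
  then show ?thesis using assms by (rule wheel_not_exchange[rotated])
qed

end
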